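(* For any $\alpha>-1$ and $\theta\in(0,\pi)$, $$J_\alpha(\theta)=\frac1{2\pi\mathsf c_\alpha}\,\sin^{2\alpha+1}\theta\int_0^\infty \mathcal K_0(x)\,e^{x\cos\theta}\,x^\alpha\,dx.$$
   Context: $\mathcal K_0(z)=\int_1^\infty e^{-zx}(x^2-1)^{-1/2}\,dx$ for $z>0$ (the zeroth modified Bessel function of the second kind). $\mathsf c_\alpha=\frac1{\sqrt\pi}2^{\alpha-1}\Gamma(\alpha+\frac12)$, with $1/\mathsf c_\alpha$ read as $0$ at the pole $\alpha=-\frac12$. The kernel function $J_\alpha$ of the $\alpha$-ReLU is $$J_\alpha(\theta)=\frac1{2\pi\mathsf c_\alpha}(\sin\theta)^{2\alpha+1}\,\Gamma(\alpha+1)\int_0^{\pi/2}\frac{\cos^\alpha\eta}{(1-\cos\theta\cos\eta)^{1+\alpha}}\,d\eta .$$ *)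

theory Defs
  imports "HOL-Analysis.Analysis"
begin

text \<open>All integrals are Lebesgue integrals. The integrands below are singular at most at end points
  of the range of integration, so including or excluding those makes no difference.\<close>

definition bessel_K0 :: "real \<Rightarrow> real" where
  "bessel_K0 z = (LBINT x:{1<..}. exp (- z * x) * (x\<^sup>2 - 1) powr (-1/2))"

text \<open>At the pole \<open>\<alpha> = -1/2\<close> the library has \<open>Gamma 0 = 0\<close>, hence \<open>c_const \<alpha> = 0\<close> and, as
  \<open>1 / 0 = 0\<close>, also \<open>1 / c_const \<alpha> = 0\<close>; this is the intended reading of \<open>1/c\<^sub>\<alpha>\<close> there.\<close>

definition c_const :: "real \<Rightarrow> real" where
  "c_const \<alpha> = 1 / sqrt pi * 2 powr (\<alpha> - 1) * Gamma (\<alpha> + 1/2)"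

definition J_kernel :: "real \<Rightarrow> real \<Rightarrow> real" where
  "J_kernel \<alpha> \<theta> =
     1 / (2 * pi * c_const \<alpha>) * (sin \<theta>) powr (2 * \<alpha> + 1) * Gamma (\<alpha> + 1) *
     (LBINT \<eta>:{0<..<pi/2}. (cos \<eta>) powr \<alpha> / (1 - cos \<theta> * cos \<eta>) powr (1 + \<alpha>))"

end

theory Submission
  imports Defs
begin

text \<open>
  Insert the integral defining \<open>K\<^sub>0\<close> and exchange the order of integration. The inner integral
  \<open>\<integral>\<^sub>0\<^sup>\<infinity> exp (-x (t - c)) x\<^sup>\<alpha> dx\<close>, where \<open>c = cos \<theta>\<close>, is
  \<open>\<Gamma>(\<alpha>+1) (t - c)\<^bsup>-(\<alpha>+1)\<^esup>\<close>, and the substitution \<open>t = 1 / cos \<eta>\<close> turns the remaining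
  integral \<open>\<integral>\<^sub>1\<^sup>\<infinity> (t\<^sup>2 - 1)\<^bsup>-1/2\<^esup> (t - c)\<^bsup>-(\<alpha>+1)\<^esup> dt\<close> into the one defining \<open>J\<^sub>\<alpha>\<close>.
\<close>

text \<open>Euler's integral for \<open>Gamma (s + 1)\<close>, rescaled by \<open>t = a * x\<close>.
  The form \<open>has_bochner_integral\<close> delivers integrability and value together; Fubini
  below uses both.\<close>

lemma has_bochner_integral_Gamma_scaled:
  fixes a s :: real
  assumes "a > 0" "s > -1"
  shows "has_bochner_integral lborel (\<lambda>x. indicator {0<..} x * (exp (- x * a) * x powr s))
           (Gamma (s + 1) * a powr (- (s + 1)))"
proof -
  let ?f = "\<lambda>t::real. indicator {0..} t * t powr s / exp t :: real"
  have "has_bochner_integral lborel ?f (Gamma (s + 1))"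
  proof (rule has_bochner_integral_nn_integral)
    show "(\<integral>\<^sup>+ t. ennreal (?f t) \<partial>lborel) = ennreal (Gamma (s + 1))"
      using Gamma_conv_nn_integral_real[of "s + 1"] assms by simp
  qed (use Gamma_real_pos[of "s + 1"] assms in auto)
  then have "has_bochner_integral lborel (\<lambda>x. ?f (0 + a * x)) (Gamma (s + 1) /\<^sub>R \<bar>a\<bar>)"
    using assms by (subst (asm) lborel_has_bochner_integral_real_affine_iff[of a _ _ 0]) auto
  \<comment> \<open>The factor \<open>a powr (- s)\<close> cancels the \<open>a powr s\<close>
    contained in \<open>(a * x) powr s\<close>.\<close>
  then have "has_bochner_integral lborel (\<lambda>x. a powr (- s) * ?f (0 + a * x))
               (a powr (- s) * (Gamma (s + 1) /\<^sub>R \<bar>a\<bar>))"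
    by (rule has_bochner_integral_mult_right)
  \<comment> \<open>The change from \<open>{0..}\<close> to \<open>{0<..}\<close> is exact at every
    point, because \<open>0 powr s = 0\<close> in HOL for every \<open>s\<close>.\<close>
  moreover have "a powr (- s) * ?f (0 + a * x) = indicator {0<..} x * (exp (- x * a) * x powr s)" for x
    using assms
    by (auto simp: indicator_def powr_mult exp_minus powr_minus field_simps zero_le_mult_iff)
  moreover have "a powr (- s) * (Gamma (s + 1) /\<^sub>R \<bar>a\<bar>) = Gamma (s + 1) * a powr (- (s + 1))"
    using assms by (simp add: powr_minus powr_diff field_simps)
  ultimately show ?thesis
    by (simp only:)
qed

text \<open>
  The singularity at \<open>\<pi>/2\<close> is handled by \<open>1 \<le> sin \<eta> + cos \<eta>\<close>: the function \<open>sin \<eta> cos\<^sup>s \<eta>\<close> has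
  an explicit antiderivative, and \<open>cos\<^bsup>s+1\<^esup> \<eta>\<close> is bounded.
\<close>

lemma set_integrable_cos_powr:
  fixes s :: real
  assumes "s > -1"
  shows "set_integrable lborel {0<..<pi/2} (\<lambda>x. cos x powr s)"
proof -
  have cos_pos: "cos x > 0" if "0 < x" "x < pi / 2" for x :: real
    using that by (intro cos_gt_zero) auto
  have "set_integrable lborel (einterval (ereal 0) (ereal (pi/2))) (\<lambda>x. sin x * cos x powr s)"
  proof (rule interval_integral_FTC_nonneg(1))
    let ?F = "\<lambda>x::real. - (cos x powr (s + 1)) / (s + 1)"
    show "DERIV ?F x :> sin x * cos x powr s"
      if "ereal 0 < ereal x" "ereal x < ereal (pi/2)" for x
    proof -
      have "DERIV (\<lambda>x. cos x powr (s + 1)) x :> - ((s + 1) * (sin x * cos x powr s))"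
        using that cos_pos[of x] by (auto intro!: derivative_eq_intros)
      from DERIV_cdivide[OF DERIV_minus[OF this], of "s + 1"] show ?thesis
        using assms by simp
    qed
    show "isCont (\<lambda>x. sin x * cos x powr s) x"
      if "ereal 0 < ereal x" "ereal x < ereal (pi/2)" for x
      using that cos_pos[of x] by (intro continuous_intros) auto
    show "AE x in lborel. ereal 0 < ereal x \<longrightarrow> ereal x < ereal (pi/2) \<longrightarrow> 0 \<le> sin x * cos x powr s"
      by (auto intro!: AE_I2 mult_nonneg_nonneg sin_ge_zero)
    \<comment> \<open>As \<open>s + 1 > 0\<close>, the antiderivative stays continuous at \<pi>/2,
      where the cosine vanishes; the boundary limits are therefore its values.\<close>
    have lim: "(?F \<longlongrightarrow> ?F x) (at x within S)" if "x \<in> {0..pi/2}" "S \<subseteq> {0..pi/2}" for x S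
    proof -
      have "continuous_on {0..pi/2} ?F"
        using assms by (intro continuous_intros continuous_on_powr') (auto intro: cos_ge_zero)
      then show ?thesis
        using that by (meson continuous_on_def tendsto_within_subset)
    qed
    have "(?F \<longlongrightarrow> ?F 0) (at 0 within {0..pi/2})" "(?F \<longlongrightarrow> ?F (pi/2)) (at (pi/2) within {0..pi/2})"
      by (rule lim; auto)+
    then have "(?F \<longlongrightarrow> ?F 0) (at_right 0)" "(?F \<longlongrightarrow> ?F (pi/2)) (at_left (pi/2))"
      by (simp_all add: at_within_Icc_at_right at_within_Icc_at_left
            del: cos_zero cos_pi_half)
    then show "((?F \<circ> real_of_ereal) \<longlongrightarrow> ?F 0) (at_right (ereal 0))"
      "((?F \<circ> real_of_ereal) \<longlongrightarrow> ?F (pi/2)) (at_left (ereal (pi/2)))"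
      by (auto simp: ereal_tendsto_simps1)
  qed auto
  then have 1: "set_integrable lborel {0<..<pi/2} (\<lambda>x. sin x * cos x powr s)"
    by simp
  have 2: "set_integrable lborel {0<..<pi/2} (\<lambda>x. 1 :: real)"
    by (simp add: set_integrable_def)
  show ?thesis
  proof (rule set_integrable_bound[OF set_integral_add(1)[OF 1 2]])
    show "set_borel_measurable lborel {0<..<pi/2} (\<lambda>x. cos x powr s)"
      unfolding set_borel_measurable_def by measurable
    show "AE x in lborel. x \<in> {0<..<pi/2} \<longrightarrow> norm (cos x powr s) \<le> norm (sin x * cos x powr s + 1)"
    proof (intro AE_I2 impI)
      fix x :: real
      assume x: "x \<in> {0<..<pi/2}"
      have pos: "sin x > 0" "cos x > 0"
        using x cos_pos by (auto intro!: sin_gt_zero)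
      have "1 \<le> (sin x + cos x)\<^sup>2"
        using pos by (simp add: power2_sum)
      then have "1 \<le> sin x + cos x"
        using pos power2_le_imp_le[of 1 "sin x + cos x"] by simp
      then have "1 * cos x powr s \<le> (sin x + cos x) * cos x powr s"
        by (rule mult_right_mono) simp
      also have "\<dots> = sin x * cos x powr s + cos x powr (s + 1)"
        using pos by (simp add: powr_add algebra_simps)
      also have "cos x powr (s + 1) \<le> 1"
        using pos assms by (intro powr_le1) auto
      finally show "norm (cos x powr s) \<le> norm (sin x * cos x powr s + 1)"
        by simp
    qed
  qed
qed

text \<open>Under \<open>t = 1 / cos \<eta>\<close> the measure
  \<open>(t\<^sup>2 - 1) powr (-1/2) dt\<close> becomes \<open>d\<eta> / cos \<eta>\<close>, and
  \<open>t - c\<close> becomes \<open>(1 - c * cos \<eta>) / cos \<eta>\<close>, so the powers of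
  \<open>cos \<eta>\<close> combine to \<open>cos \<eta> powr \<alpha>\<close>. The integrands are
  nonnegative, so integrability on the bounded interval carries back to the half-line.\<close>

lemma
  fixes \<alpha> c :: real
  assumes "\<alpha> > -1" and c: "\<bar>c\<bar> < 1"
  shows set_integrable_secant_substitution:
      "set_integrable lborel {1<..} (\<lambda>t. (t\<^sup>2 - 1) powr (-1/2) * (t - c) powr (- (\<alpha> + 1)))"
    and set_integral_secant_substitution:
      "(LBINT t:{1<..}. (t\<^sup>2 - 1) powr (-1/2) * (t - c) powr (- (\<alpha> + 1))) =
       (LBINT \<eta>:{0<..<pi/2}. cos \<eta> powr \<alpha> / (1 - c * cos \<eta>) powr (1 + \<alpha>))"
proof -
  let ?f = "\<lambda>t::real. (t\<^sup>2 - 1) powr (-1/2) * (t - c) powr (- (\<alpha> + 1))"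
  let ?h = "\<lambda>\<eta>::real. cos \<eta> powr \<alpha> / (1 - c * cos \<eta>) powr (1 + \<alpha>)"
  let ?g = "\<lambda>\<eta>::real. 1 / cos \<eta>"
  let ?g' = "\<lambda>\<eta>::real. sin \<eta> / (cos \<eta>)\<^sup>2"
  have trig: "0 < cos \<eta>" "cos \<eta> < 1" "0 < sin \<eta>" if "0 < \<eta>" "\<eta> < pi / 2" for \<eta> :: real
    using that cos_gt_zero[of \<eta>] sin_gt_zero[of \<eta>] cos_monotone_0_pi[of 0 \<eta>] by auto
  \<comment> \<open>This bound is uniform in \<eta> and positive, so the denominator of
    \<open>?h\<close> only costs a constant and \<open>cos \<eta> powr \<alpha>\<close>
    dominates.\<close>
  have c_cos: "1 - \<bar>c\<bar> \<le> 1 - c * cos \<eta>" for \<eta>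
    using abs_cos_le_one[of \<eta>] mult_left_le[of "\<bar>cos \<eta>\<bar>" "\<bar>c\<bar>"]
      abs_ge_self[of "c * cos \<eta>"] by (simp add: abs_mult)
  have fg: "?f (?g \<eta>) * ?g' \<eta> = ?h \<eta>" if "\<eta> \<in> {0<..<pi/2}" for \<eta>
  proof -
    have pos: "0 < cos \<eta>" "0 < sin \<eta>"
      using that trig by auto
    have "(?g \<eta>)\<^sup>2 - 1 = (sin \<eta> / cos \<eta>)\<^sup>2"
      using pos by (simp add: power_divide sin_squared_eq field_simps)
    also have "\<dots> powr (-1/2) = cos \<eta> / sin \<eta>"
      using pos by (simp add: powr_minus powr_half_sqrt real_sqrt_divide)
    finally have 1: "((?g \<eta>)\<^sup>2 - 1) powr (-1/2) = cos \<eta> / sin \<eta>" .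
    have "?g \<eta> - c = (1 - c * cos \<eta>) / cos \<eta>"
      using pos by (simp add: field_simps)
    then have 2: "(?g \<eta> - c) powr (- (\<alpha> + 1)) = cos \<eta> powr (\<alpha> + 1) / (1 - c * cos \<eta>) powr (1 + \<alpha>)"
      unfolding powr_minus_divide using pos c_cos[of \<eta>] c by (simp add: powr_divide add.commute)
    show ?thesis
      unfolding 1 2 using pos by (simp add: powr_add power2_eq_square)
  qed
  have int_h: "set_integrable lborel {0<..<pi/2} ?h"
  proof (rule set_integrable_bound)
    show "set_integrable lborel {0<..<pi/2} (\<lambda>\<eta>. (1 - \<bar>c\<bar>) powr (- (1 + \<alpha>)) * cos \<eta> powr \<alpha>)"
      using assms by (intro set_integrable_mult_right set_integrable_cos_powr) auto
    show "set_borel_measurable lborel {0<..<pi/2} ?h"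
      unfolding set_borel_measurable_def by measurable
    show "AE \<eta> in lborel. \<eta> \<in> {0<..<pi/2} \<longrightarrow>
        norm (?h \<eta>) \<le> norm ((1 - \<bar>c\<bar>) powr (- (1 + \<alpha>)) * cos \<eta> powr \<alpha>)"
    proof (intro AE_I2 impI)
      fix \<eta> :: real
      have "(1 - c * cos \<eta>) powr (- (1 + \<alpha>)) \<le> (1 - \<bar>c\<bar>) powr (- (1 + \<alpha>))"
        using c c_cos[of \<eta>] assms by (intro powr_mono2') auto
      then have "cos \<eta> powr \<alpha> * (1 - c * cos \<eta>) powr (- (1 + \<alpha>))
          \<le> cos \<eta> powr \<alpha> * (1 - \<bar>c\<bar>) powr (- (1 + \<alpha>))"
        by (rule mult_left_mono) simp
      then show "norm (?h \<eta>) \<le> norm ((1 - \<bar>c\<bar>) powr (- (1 + \<alpha>)) * cos \<eta> powr \<alpha>)"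
        by (simp only: powr_minus_divide) (simp add: mult.commute)
    qed
  qed
  have lim0: "((ereal \<circ> ?g \<circ> real_of_ereal) \<longlongrightarrow> ereal 1) (at_right (ereal 0))"
  proof -
    have "(?g \<longlongrightarrow> 1 / cos 0) (at_right 0)"
      by (intro tendsto_intros) auto
    from tendsto_ereal[OF this] show ?thesis
      unfolding ereal_tendsto_simps1 by (simp add: o_def)
  qed
  have lim1: "((ereal \<circ> ?g \<circ> real_of_ereal) \<longlongrightarrow> \<infinity>) (at_left (ereal (pi/2)))"
  proof -
    have "((\<lambda>x::real. cos x) \<longlongrightarrow> cos (pi/2)) (at_left (pi/2))"
      by (intro tendsto_intros)
    \<comment> \<open>The cosine must tend to 0 through positive values for its reciprocal to tend
      to plus infinity.\<close>
    moreover have "eventually (\<lambda>x::real. x \<in> {0<..<pi/2}) (at_left (pi/2))"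
      by (rule eventually_at_left_real) simp
    then have "eventually (\<lambda>x::real. 0 < cos x) (at_left (pi/2))"
      by eventually_elim (use trig in auto)
    ultimately have cos_lim: "filterlim (\<lambda>x::real. cos x) (at_right 0) (at_left (pi/2))"
      by (auto simp: filterlim_at elim: eventually_mono)
    have "filterlim ?g at_top (at_left (pi/2))"
      using filterlim_compose[OF filterlim_inverse_at_top_right cos_lim]
      unfolding inverse_eq_divide .
    then show ?thesis
      unfolding ereal_tendsto_simps1 by (simp add: o_def tendsto_PInfty_eq_at_top)
  qed
  have lt: "ereal 0 < ereal (pi/2)"
    by simp
  have deriv: "DERIV ?g \<eta> :> ?g' \<eta>" if "ereal 0 < ereal \<eta>" "ereal \<eta> < ereal (pi/2)" for \<eta>
    using that trig[of \<eta>] by (auto intro!: derivative_eq_intros simp: power2_eq_square)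
  have contf: "isCont ?f (?g \<eta>)" if "ereal 0 < ereal \<eta>" "ereal \<eta> < ereal (pi/2)" for \<eta>
  proof -
    have "1 < ?g \<eta>"
      using that trig[of \<eta>] by simp
    then have "(?g \<eta>)\<^sup>2 - 1 \<noteq> 0" "?g \<eta> - c \<noteq> 0"
      using c one_less_power[of "?g \<eta>" 2] by linarith+
    then show ?thesis
      by (intro continuous_intros) auto
  qed
  have contg': "isCont ?g' \<eta>" if "ereal 0 < ereal \<eta>" "ereal \<eta> < ereal (pi/2)" for \<eta>
    using that trig[of \<eta>] by (intro continuous_intros) auto
  have f_nonneg: "0 \<le> ?f (?g \<eta>)" if "ereal 0 < ereal \<eta>" "ereal \<eta> < ereal (pi/2)" for \<eta>
    by simp
  \<comment> \<open>The substitution rule asks for this on the closed interval; at \<pi>/2 the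
    quotient has denominator 0 and hence the value 0.\<close>
  have g'_nonneg: "0 \<le> ?g' \<eta>" if "ereal 0 \<le> ereal \<eta>" "ereal \<eta> \<le> ereal (pi/2)" for \<eta>
    using that by (intro divide_nonneg_nonneg sin_ge_zero) auto
  have int_fg: "set_integrable lborel (einterval (ereal 0) (ereal (pi/2))) (\<lambda>\<eta>. ?f (?g \<eta>) * ?g' \<eta>)"
    using int_h set_integrable_cong[OF refl refl fg, of "{0<..<pi/2}" "\<lambda>\<eta>. \<eta>" lborel]
    by (simp only: einterval_eq)
  note subst = interval_integral_substitution_nonneg
    [OF lt deriv contf contg' f_nonneg g'_nonneg lim0 lim1 int_fg]
  show "set_integrable lborel {1<..} ?f"
    using subst(1) by simp
  have "(LBINT t:{1<..}. ?f t) = (LBINT \<eta>:{0<..<pi/2}. ?f (?g \<eta>) * ?g' \<eta>)"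
    using subst(2) by (simp add: interval_lebesgue_integral_def)
  also have "\<dots> = (LBINT \<eta>:{0<..<pi/2}. ?h \<eta>)"
    by (rule set_lebesgue_integral_cong) (use fg in auto)
  finally show "(LBINT t:{1<..}. ?f t) = (LBINT \<eta>:{0<..<pi/2}. ?h \<eta>)" .
qed

text \<open>Tonelli's argument for the nonnegative \<open>F\<close>: integrating in \<open>x\<close>
  first gives \<open>Gamma (\<alpha> + 1)\<close> times the integrand of the secant substitution,
  whose integrability is known. Hence \<open>F\<close> is integrable on the product, and Fubini
  yields integrability in \<open>x\<close> as well as the equality.\<close>

lemma
  fixes \<alpha> c :: real
  assumes "\<alpha> > -1" and c: "\<bar>c\<bar> < 1"
  shows set_integrable_bessel_K0_exp_powr:
      "set_integrable lborel {0<..} (\<lambda>x. bessel_K0 x * exp (x * c) * x powr \<alpha>)"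
    and set_integral_bessel_K0_exp_powr:
      "(LBINT x:{0<..}. bessel_K0 x * exp (x * c) * x powr \<alpha>) =
       Gamma (\<alpha> + 1) * (LBINT t:{1<..}. (t\<^sup>2 - 1) powr (-1/2) * (t - c) powr (- (\<alpha> + 1)))"
proof -
  \<comment> \<open>Both ranges are encoded by indicators, so that Fubini applies on the whole
    plane. The exponential in \<open>F\<close> merges that of the Bessel integral with
    \<open>exp (x * c)\<close>.\<close>
  define w where "w t = indicator {1<..} t * (t\<^sup>2 - 1) powr (-1/2)" for t :: real
  define F where "F t x = w t * (indicator {0<..} x * (exp (- x * (t - c)) * x powr \<alpha>))" for t x :: real
  have w_nonneg: "w t \<ge> 0" for t
    by (simp add: w_def)
  have F_nonneg: "F t x \<ge> 0" for t x
    by (simp add: F_def w_nonneg)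
  have F_t: "has_bochner_integral lborel (F t) (w t * (Gamma (\<alpha> + 1) * (t - c) powr (- (\<alpha> + 1))))" for t
  proof (cases "t > 1")
    case True
    then show ?thesis
      unfolding F_def using assms
      by (intro has_bochner_integral_mult_right has_bochner_integral_Gamma_scaled) auto
  next
    case False
    then have "F t = (\<lambda>_. 0)" "w t = 0"
      by (auto simp: F_def w_def)
    then show ?thesis
      by (simp add: has_bochner_integral_zero)
  qed
  \<comment> \<open>The factors depending only on \<open>x\<close> leave the integral, and the
    defining integral of \<open>bessel_K0 x\<close> remains.\<close>
  have F_x: "(LBINT t. F t x) = indicator {0<..} x * (bessel_K0 x * exp (x * c) * x powr \<alpha>)" for x
  proof -
    have "F t x = (indicator {0<..} x * exp (x * c) * x powr \<alpha>) *
        (indicator {1<..} t *\<^sub>R (exp (- x * t) * (t\<^sup>2 - 1) powr (-1/2)))" for t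
      by (simp add: F_def w_def right_diff_distrib exp_add [symmetric] algebra_simps)
    then show ?thesis
      by (simp add: bessel_K0_def set_lebesgue_integral_def)
  qed
  have int_t: "integrable lborel (\<lambda>t. w t * (Gamma (\<alpha> + 1) * (t - c) powr (- (\<alpha> + 1))))"
    using integrable_mult_right[OF set_integrable_secant_substitution[OF assms, unfolded set_integrable_def],
        of "Gamma (\<alpha> + 1)"]
    by (simp add: w_def mult_ac)
  have int_F: "integrable (lborel \<Otimes>\<^sub>M lborel) (case_prod F)"
  proof (rule lborel_pair.Fubini_integrable)
    show "case_prod F \<in> borel_measurable (lborel \<Otimes>\<^sub>M lborel)"
      unfolding F_def w_def by measurable
    show "integrable lborel (\<lambda>t. LBINT x. norm (case_prod F (t, x)))"
      using int_t F_t F_nonneg by (simp add: has_bochner_integral_iff)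
    show "AE t in lborel. integrable lborel (\<lambda>x. case_prod F (t, x))"
      using F_t by (simp add: has_bochner_integral_iff)
  qed
  show "set_integrable lborel {0<..} (\<lambda>x. bessel_K0 x * exp (x * c) * x powr \<alpha>)"
    using lborel_pair.integrable_snd[OF int_F] by (simp add: F_x set_integrable_def)
  have "(LBINT x:{0<..}. bessel_K0 x * exp (x * c) * x powr \<alpha>) = (LBINT x. LBINT t. F t x)"
    by (simp add: F_x set_lebesgue_integral_def)
  also have "\<dots> = (LBINT t. LBINT x. F t x)"
    by (rule lborel_pair.Fubini_integral[OF int_F])
  also have "\<dots> = (LBINT t. Gamma (\<alpha> + 1) *
      (indicator {1<..} t *\<^sub>R ((t\<^sup>2 - 1) powr (-1/2) * (t - c) powr (- (\<alpha> + 1)))))"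
    using F_t by (simp add: has_bochner_integral_iff w_def mult_ac)
  finally show "(LBINT x:{0<..}. bessel_K0 x * exp (x * c) * x powr \<alpha>) =
       Gamma (\<alpha> + 1) * (LBINT t:{1<..}. (t\<^sup>2 - 1) powr (-1/2) * (t - c) powr (- (\<alpha> + 1)))"
    by (simp add: set_lebesgue_integral_def)
qed

theorem lemmaC31:
  fixes \<alpha> \<theta> :: real
  assumes "\<alpha> > -1" and "\<theta> \<in> {0<..<pi}"
  shows "set_integrable lborel {0<..} (\<lambda>x. bessel_K0 x * exp (x * cos \<theta>) * x powr \<alpha>) \<and>
         J_kernel \<alpha> \<theta> = 1 / (2 * pi * c_const \<alpha>) * (sin \<theta>) powr (2 * \<alpha> + 1) *
           (LBINT x:{0<..}. bessel_K0 x * exp (x * cos \<theta>) * x powr \<alpha>)"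
proof -
  have "cos \<theta> < 1" "- 1 < cos \<theta>"
    using assms(2) cos_monotone_0_pi[of 0 \<theta>] cos_monotone_0_pi[of \<theta> pi] by auto
  then have c: "\<bar>cos \<theta>\<bar> < 1"
    by simp
  \<comment> \<open>Both sides carry the same factor \<open>1 / (2 * pi * c_const \<alpha>)\<close>,
    so the pole at \<alpha> = -1/2 calls for no separate case.\<close>
  show ?thesis
    unfolding J_kernel_def set_integral_bessel_K0_exp_powr[OF assms(1) c]
      set_integral_secant_substitution[OF assms(1) c]
    using set_integrable_bessel_K0_exp_powr[OF assms(1) c] by simp
qed

end
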